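(* Let $\Omega\subset\mathbb{R}^n$ be a bounded domain with boundary $\partial\Omega$, and let $$\mathcal{L}u=\sum_{i,j=1}^n a_{ij}u_{x_ix_j}+\sum_{i=1}^n b_i u_{x_i}+cu$$ be a uniformly elliptic operator on $\Omega$ with continuous coefficients $a_{ij}, b_i, c$ and with $c\le 0$ on $\Omega$. Let $u$ be a solution of $\mathcal{L}u=f$ on $\Omega$ with boundary values $u|_{\partial\Omega}=g$, and let $v$ be a solution of $\mathcal{L}v=f$ on $\Omega$ with boundary values $v|_{\partial\Omega}=g+\epsilon$, where $\epsilon$ is a function on $\partial\Omega$. Then $$\max|v-u|\le\max|\epsilon|.$$
   Context: The coefficients $a_{ij}, b_i, c$ are continuous real-valued functions on $\Omega$. The operator $\mathcal{L}$ is uniformly elliptic on $\Omega$ if there is a constant $\theta_0>0$ such that $\sum_{i,j=1}^n a_{ij}(x)\xi_i\xi_j\ge\theta_0\sum_{i=1}^n\xi_i^2$ for all $x\in\Omega$ and all $\xi\in\mathbb{R}^n$. Solutions are classical: they belong to $\mathcal{C}^2(\Omega)\cap\mathcal{C}^0(\overline{\Omega})$ and take the prescribed boundary values on $\partial\Omega$. Here $\max|v-u|$ is the maximum over $\overline{\Omega}$ and $\max|\epsilon|$ is the maximum over $\partial\Omega$. *)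

theory Defs
  imports "HOL-Analysis.Analysis"
begin

definition partial :: "'n::finite \<Rightarrow> (real^'n \<Rightarrow> real) \<Rightarrow> real^'n \<Rightarrow> real" where
  "partial i u x = deriv (\<lambda>t. u (x + t *\<^sub>R axis i 1)) 0"

definition has_partial_at :: "'n::finite \<Rightarrow> (real^'n \<Rightarrow> real) \<Rightarrow> real^'n \<Rightarrow> bool" where
  "has_partial_at i u x \<longleftrightarrow> (\<lambda>t. u (x + t *\<^sub>R axis i 1)) field_differentiable (at 0)"

text \<open>The class \<open>C\<^sup>k(S)\<close>, meant for open \<open>S\<close>: all partial derivatives of order at most \<open>k\<close>
  exist and are continuous on \<open>S\<close>.  The values of \<open>u\<close> outside the open set \<open>S\<close> are irrelevant.\<close>

primrec C_class :: "nat \<Rightarrow> (real^'n::finite) set \<Rightarrow> (real^'n \<Rightarrow> real) \<Rightarrow> bool" where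
  "C_class 0 S u \<longleftrightarrow> continuous_on S u"
| "C_class (Suc k) S u \<longleftrightarrow> continuous_on S u \<and>
     (\<forall>i. (\<forall>x\<in>S. has_partial_at i u x) \<and> C_class k S (partial i u))"

definition bounded_domain :: "(real^'n::finite) set \<Rightarrow> bool" where
  "bounded_domain \<Omega> \<longleftrightarrow> open \<Omega> \<and> connected \<Omega> \<and> \<Omega> \<noteq> {} \<and> bounded \<Omega>"

definition diff_op ::
  "('n::finite \<Rightarrow> 'n \<Rightarrow> real^'n \<Rightarrow> real) \<Rightarrow> ('n \<Rightarrow> real^'n \<Rightarrow> real) \<Rightarrow> (real^'n \<Rightarrow> real) \<Rightarrow>
   (real^'n \<Rightarrow> real) \<Rightarrow> real^'n \<Rightarrow> real" where
  "diff_op a b c u x =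
     (\<Sum>i\<in>UNIV. \<Sum>j\<in>UNIV. a i j x * partial j (partial i u) x)
     + (\<Sum>i\<in>UNIV. b i x * partial i u x) + c x * u x"

definition uniformly_elliptic ::
  "(real^'n::finite) set \<Rightarrow> ('n \<Rightarrow> 'n \<Rightarrow> real^'n \<Rightarrow> real) \<Rightarrow> bool" where
  "uniformly_elliptic \<Omega> a \<longleftrightarrow>
     (\<exists>\<theta>>0. \<forall>x\<in>\<Omega>. \<forall>\<xi>::real^'n.
        (\<Sum>i\<in>UNIV. \<Sum>j\<in>UNIV. a i j x * \<xi> $ i * \<xi> $ j) \<ge> \<theta> * (\<Sum>i\<in>UNIV. (\<xi> $ i)\<^sup>2))"

text \<open>Classical solutions of the Dirichlet problem for a differential operator \<open>L\<close>.
  Functions on \<open>\<Omega>\<close>, its closure or its boundary are total functions on the whole space,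
  of which only the values on the set in question are used.\<close>

definition dirichlet_solution ::
  "((real^'n::finite \<Rightarrow> real) \<Rightarrow> real^'n \<Rightarrow> real) \<Rightarrow> (real^'n) set \<Rightarrow>
   (real^'n \<Rightarrow> real) \<Rightarrow> (real^'n \<Rightarrow> real) \<Rightarrow> (real^'n \<Rightarrow> real) \<Rightarrow> bool" where
  "dirichlet_solution L \<Omega> f g u \<longleftrightarrow>
     C_class 2 \<Omega> u \<and> continuous_on (closure \<Omega>) u \<and>
     (\<forall>x\<in>\<Omega>. L u x = f x) \<and> (\<forall>x\<in>frontier \<Omega>. u x = g x)"

text \<open>The maximum of \<open>h\<close> over \<open>S\<close>; the library's \<open>Max\<close> only covers finite sets.  The value is
  unspecified if the maximum is not attained, which cannot happen for continuous \<open>h\<close> on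
  nonempty compact \<open>S\<close>.\<close>

definition max_over :: "'a set \<Rightarrow> ('a \<Rightarrow> real) \<Rightarrow> real" where
  "max_over S h = (GREATEST y. y \<in> h ` S)"

lemma max_over_attained:
  fixes h :: "'a::topological_space \<Rightarrow> real"
  assumes "compact S" "S \<noteq> {}" "continuous_on S h"
  shows "max_over S h \<in> h ` S" and "\<And>x. x \<in> S \<Longrightarrow> h x \<le> max_over S h"
proof -
  obtain x0 where x0: "x0 \<in> S" "\<forall>x\<in>S. h x \<le> h x0"
    using continuous_attains_sup[OF assms] by blast
  then have "max_over S h = h x0"
    unfolding max_over_def by (intro Greatest_equality) auto
  with x0 show "max_over S h \<in> h ` S" and "\<And>x. x \<in> S \<Longrightarrow> h x \<le> max_over S h"
    by auto
qed

end

theory Submission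
  imports Defs
begin

text \<open>
  The difference \<open>w = v - u\<close> solves the homogeneous equation and equals \<open>\<epsilon>\<close> on the boundary,
  so the estimate is the weak maximum principle applied to \<open>w\<close> and to \<open>-w\<close>, with the
  nonnegative bound \<open>M = max \<bar>\<epsilon>\<bar>\<close>.

  The maximum principle (\<open>maximum_principle\<close>) rests on the fact that at an interior maximum the
  gradient vanishes and \<open>\<Sum>\<^sub>i\<^sub>j a\<^sub>i\<^sub>j h\<^sub>i\<^sub>j \<le> 0\<close>; a strict differential inequality for \<open>h\<close> is
  incompatible with this. Strictness is obtained by adding a small multiple of
  \<open>exp (\<gamma> x\<^sub>k)\<close>, whose second derivative dominates the first-order term once \<open>\<gamma>\<close> is large
  compared with \<open>b\<^sub>k\<close>. The coefficients are continuous only on the open set \<open>\<Omega>\<close>, so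
  \<open>b\<^sub>k\<close> may be unbounded near the boundary and no \<open>\<gamma>\<close> need work on all of \<open>\<Omega>\<close>. If
  \<open>w\<close> exceeds \<open>M\<close> somewhere, however, then a superlevel set \<open>{w \<ge> m}\<close> with \<open>m > M\<close> is a
  compact subset of \<open>\<Omega>\<close>. It suffices to choose \<open>\<gamma>\<close> for this set, because a sufficiently
  small perturbation has its maximum there.

  Two ingredients come from calculus and linear algebra. A function all of whose partial
  derivatives are continuous is Frechet differentiable
  (\<open>has_derivative_of_continuous_partials\<close>). Applied twice, this turns the coordinatewise
  notion of \<open>C\<^sup>2\<close> into Frechet derivatives of \<open>u\<close> and of its gradient, from which the
  symmetry of the Hessian (\<open>hessian_symmetric\<close>) and its sign at a maximum
  (\<open>gradient_hessian_at_maximum\<close>) follow. The trace inequality \<open>tr (A H) \<le> 0\<close> for positive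
  definite \<open>A\<close> and symmetric negative semidefinite \<open>H\<close> is \<open>trace_product_nonpos\<close>.
\<close>

section \<open>The trace of a product of a positive and a negative form\<close>

lemma sum_sum_insert:
  fixes F :: "'a \<Rightarrow> 'a \<Rightarrow> real"
  assumes "finite S" "k \<notin> S"
  shows "(\<Sum>i\<in>insert k S. \<Sum>j\<in>insert k S. F i j)
    = F k k + (\<Sum>j\<in>S. F k j) + (\<Sum>i\<in>S. F i k) + (\<Sum>i\<in>S. \<Sum>j\<in>S. F i j)"
  using assms by (simp add: sum.distrib)

text \<open>
  Gaussian elimination, one index at a time: with pivot \<open>p = A\<^sub>k\<^sub>k > 0\<close>, the matrix \<open>A\<close> is the
  sum of the Schur complement \<open>B\<^sub>i\<^sub>j = A\<^sub>i\<^sub>j - A\<^sub>i\<^sub>k A\<^sub>k\<^sub>j / p\<close>, which vanishes in row and column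
  \<open>k\<close>, and a rank-one matrix. The rank-one part contributes the value of the form \<open>H\<close> at the
  \<open>k\<close>-th column of \<open>A\<close>, divided by \<open>p\<close>; the Schur complement is handled by induction, since it
  keeps the same ellipticity constant.
\<close>

lemma trace_product_nonpos_symmetric:
  fixes A H :: "'a \<Rightarrow> 'a \<Rightarrow> real"
  assumes "finite S" and "\<theta> > 0"
    and "\<And>i j. A i j = A j i"
    and "\<And>\<xi>. \<theta> * (\<Sum>i\<in>S. (\<xi> i)\<^sup>2) \<le> (\<Sum>i\<in>S. \<Sum>j\<in>S. A i j * \<xi> i * \<xi> j)"
    and "\<And>\<xi>. (\<Sum>i\<in>S. \<Sum>j\<in>S. H i j * \<xi> i * \<xi> j) \<le> 0"
  shows "(\<Sum>i\<in>S. \<Sum>j\<in>S. A i j * H i j) \<le> 0"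
  using assms(1,3,4,5)
proof (induction S arbitrary: A rule: finite_induct)
  case empty
  then show ?case by simp
next
  case (insert k S)
  note fin = insert.hyps
  note A_sym = insert.prems(1)
  note A_pos = insert.prems(2)
  note H_neg = insert.prems(3)
  define p where "p = A k k"
  have "\<theta> * (\<Sum>i\<in>insert k S. ((\<lambda>i. if i = k then 1 else 0) i)\<^sup>2)
     \<le> (\<Sum>i\<in>insert k S. \<Sum>j\<in>insert k S. A i j * (if i = k then 1 else 0) * (if j = k then 1 else 0))"
    using A_pos[of "\<lambda>i. if i = k then 1 else 0"] .
  moreover have "(\<Sum>i\<in>insert k S. (if i = k then 1 else (0::real))\<^sup>2) = 1"
    using fin by (simp add: if_distrib[of "\<lambda>x. x\<^sup>2"] cong: if_cong)
  moreover have "(\<Sum>i\<in>insert k S. \<Sum>j\<in>insert k S. A i j * (if i = k then 1 else 0) * (if j = k then 1 else 0)) = p"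
  proof -
    have "i \<in> S \<Longrightarrow> i \<noteq> k" for i using fin by auto
    then show ?thesis
      unfolding sum_sum_insert[OF fin] p_def by simp
  qed
  ultimately have p: "p > 0" using \<open>\<theta> > 0\<close> by simp
  define B where "B i j = A i j - A i k * A k j / p" for i j
  have B_sym: "B i j = B j i" for i j
    unfolding B_def using A_sym by (metis mult.commute)
  have B_pos: "\<theta> * (\<Sum>i\<in>S. (\<xi> i)\<^sup>2) \<le> (\<Sum>i\<in>S. \<Sum>j\<in>S. B i j * \<xi> i * \<xi> j)" for \<xi>
  proof -
    \<comment> \<open>For given \<open>\<xi>\<close> on \<open>S\<close>, the value \<open>- q / p\<close> at \<open>k\<close> minimises the form of \<open>A\<close>; the minimum
      is the form of \<open>B\<close> at \<open>\<xi>\<close>.\<close>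
    define q where "q = (\<Sum>j\<in>S. A k j * \<xi> j)"
    define \<eta> where "\<eta> = \<xi>(k := - q / p)"
    have \<eta>: "\<eta> k = - q / p" "\<And>i. i \<in> S \<Longrightarrow> \<eta> i = \<xi> i"
      using fin by (auto simp: \<eta>_def)
    have q': "(\<Sum>i\<in>S. A i k * \<xi> i) = q"
      unfolding q_def using A_sym by (intro sum.cong) auto
    have "\<theta> * (\<Sum>i\<in>S. (\<xi> i)\<^sup>2) \<le> \<theta> * (\<Sum>i\<in>insert k S. (\<eta> i)\<^sup>2)"
      using fin \<eta> \<open>\<theta> > 0\<close> by (simp)
    also have "\<dots> \<le> (\<Sum>i\<in>insert k S. \<Sum>j\<in>insert k S. A i j * \<eta> i * \<eta> j)"
      by (rule A_pos)
    also have "\<dots> = p * (- q / p)\<^sup>2 + (- q / p) * q + (- q / p) * q + (\<Sum>i\<in>S. \<Sum>j\<in>S. A i j * \<xi> i * \<xi> j)"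
    proof -
      have "(\<Sum>j\<in>S. A k j * \<eta> k * \<eta> j) = (- q / p) * q"
        unfolding \<eta>(1) q_def sum_distrib_left using \<eta> by (intro sum.cong) auto
      moreover have "(\<Sum>i\<in>S. A i k * \<eta> i * \<eta> k) = (- q / p) * q"
        unfolding \<eta>(1) q'[symmetric] sum_distrib_left using \<eta> by (intro sum.cong) auto
      moreover have "(\<Sum>i\<in>S. \<Sum>j\<in>S. A i j * \<eta> i * \<eta> j) = (\<Sum>i\<in>S. \<Sum>j\<in>S. A i j * \<xi> i * \<xi> j)"
        using \<eta> by (intro sum.cong) auto
      ultimately show ?thesis
        unfolding sum_sum_insert[OF fin] by (simp add: \<eta> p_def power2_eq_square)
    qed
    also have "\<dots> = (\<Sum>i\<in>S. \<Sum>j\<in>S. A i j * \<xi> i * \<xi> j) - q * q / p"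
      using p by (simp add: power2_eq_square field_simps)
    also have "q * q / p = (\<Sum>i\<in>S. \<Sum>j\<in>S. A i k * A k j / p * \<xi> i * \<xi> j)"
    proof -
      have "q * q / p = (\<Sum>i\<in>S. A i k * \<xi> i) * (\<Sum>j\<in>S. A k j * \<xi> j) / p"
        by (simp only: q' flip: q_def)
      then show ?thesis
        by (simp add: sum_product sum_divide_distrib mult_ac)
    qed
    finally show ?thesis
      by (simp add: B_def left_diff_distrib sum_subtractf)
  qed
  have H_neg_S: "(\<Sum>i\<in>S. \<Sum>j\<in>S. H i j * \<xi> i * \<xi> j) \<le> 0" for \<xi>
  proof -
    have "(\<Sum>i\<in>S. \<Sum>j\<in>S. H i j * (\<xi>(k := 0)) i * (\<xi>(k := 0)) j) = (\<Sum>i\<in>S. \<Sum>j\<in>S. H i j * \<xi> i * \<xi> j)"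
      using fin by (intro sum.cong) auto
    with H_neg[of "\<xi>(k := 0)"] show ?thesis
      unfolding sum_sum_insert[OF fin] by simp
  qed
  have IH: "(\<Sum>i\<in>S. \<Sum>j\<in>S. B i j * H i j) \<le> 0"
    by (rule insert.IH[OF B_sym B_pos H_neg_S])
  have "(\<Sum>i\<in>insert k S. \<Sum>j\<in>insert k S. A i j * H i j)
      = (\<Sum>i\<in>insert k S. \<Sum>j\<in>insert k S. B i j * H i j)
        + (\<Sum>i\<in>insert k S. \<Sum>j\<in>insert k S. A i k * A k j / p * H i j)"
    by (simp only: B_def left_diff_distrib sum_subtractf)
  also have "(\<Sum>i\<in>insert k S. \<Sum>j\<in>insert k S. B i j * H i j) = (\<Sum>i\<in>S. \<Sum>j\<in>S. B i j * H i j)"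
    using p unfolding sum_sum_insert[OF fin] by (simp add: B_def p_def)
  also have "(\<Sum>i\<in>insert k S. \<Sum>j\<in>insert k S. A i k * A k j / p * H i j)
      = (\<Sum>i\<in>insert k S. \<Sum>j\<in>insert k S. H i j * A i k * A j k) / p"
    unfolding sum_divide_distrib
    by (intro sum.cong) (auto simp: A_sym[of k])
  also have "\<dots> \<le> 0"
    using H_neg[of "\<lambda>i. A i k"] p by (simp only: divide_nonpos_pos)
  finally show ?case using IH by linarith
qed

text \<open>
  Transposing \<open>A\<close> changes neither its quadratic form nor, by symmetry of \<open>H\<close>, the trace of the
  product. Hence \<open>A\<close> may be replaced by \<open>A + A\<^sup>T\<close>, at the price of a factor 2.
\<close>

lemma trace_product_nonpos:
  fixes A H :: "'a \<Rightarrow> 'a \<Rightarrow> real"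
  assumes "finite S" and "\<theta> > 0"
    and H_sym: "\<And>i j. H i j = H j i"
    and A_pos: "\<And>\<xi>. \<theta> * (\<Sum>i\<in>S. (\<xi> i)\<^sup>2) \<le> (\<Sum>i\<in>S. \<Sum>j\<in>S. A i j * \<xi> i * \<xi> j)"
    and H_neg: "\<And>\<xi>. (\<Sum>i\<in>S. \<Sum>j\<in>S. H i j * \<xi> i * \<xi> j) \<le> 0"
  shows "(\<Sum>i\<in>S. \<Sum>j\<in>S. A i j * H i j) \<le> 0"
proof -
  define B where "B i j = A i j + A j i" for i j
  have B_split: "(\<Sum>i\<in>S. \<Sum>j\<in>S. B i j * X i j) = 2 * (\<Sum>i\<in>S. \<Sum>j\<in>S. A i j * X i j)"
    if "\<And>i j. X i j = X j i" for X :: "'a \<Rightarrow> 'a \<Rightarrow> real"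
  proof -
    have "(\<Sum>i\<in>S. \<Sum>j\<in>S. A j i * X i j) = (\<Sum>i\<in>S. \<Sum>j\<in>S. A i j * X i j)"
      by (subst sum.swap) (intro sum.cong refl arg_cong2[where f = "(*)"] that)
    then show ?thesis
      by (simp add: B_def distrib_right sum.distrib)
  qed
  have "(\<Sum>i\<in>S. \<Sum>j\<in>S. B i j * H i j) \<le> 0"
  proof (rule trace_product_nonpos_symmetric[OF \<open>finite S\<close>, of "2 * \<theta>"])
    show "B i j = B j i" for i j by (simp add: B_def)
    show "2 * \<theta> * (\<Sum>i\<in>S. (\<xi> i)\<^sup>2) \<le> (\<Sum>i\<in>S. \<Sum>j\<in>S. B i j * \<xi> i * \<xi> j)" for \<xi>
      using A_pos[of \<xi>] B_split[of "\<lambda>i j. \<xi> i * \<xi> j", OF mult.commute] by (simp add: mult.assoc)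
  qed (use \<open>\<theta> > 0\<close> H_neg in auto)
  with B_split[of H] H_sym show ?thesis by simp
qed

section \<open>From continuous partial derivatives to Frechet derivatives\<close>

lemma has_partial_at_imp_DERIV:
  assumes "has_partial_at i u (z + t *\<^sub>R axis i 1)"
  shows "((\<lambda>s. u (z + s *\<^sub>R axis i 1)) has_real_derivative partial i u (z + t *\<^sub>R axis i 1)) (at t)"
proof -
  have "((\<lambda>s. u (z + t *\<^sub>R axis i 1 + s *\<^sub>R axis i 1)) has_real_derivative partial i u (z + t *\<^sub>R axis i 1)) (at 0)"
    using assms unfolding has_partial_at_def partial_def field_differentiable_derivI
    by (simp add: field_differentiable_derivI)
  then have "((\<lambda>s. u (z + (s + t) *\<^sub>R axis i 1)) has_real_derivative partial i u (z + t *\<^sub>R axis i 1)) (at 0)"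
    by (simp add: scaleR_left_distrib add_ac)
  then show ?thesis
    using DERIV_shift[of "\<lambda>s. u (z + s *\<^sub>R axis i 1)" _ 0 t] by simp
qed

lemma sum_axis_component:
  fixes h :: "'n::finite \<Rightarrow> real"
  shows "(\<Sum>i\<in>T. h i *\<^sub>R axis i (1::real)) $ m = (if m \<in> T then h m else 0)"
proof -
  have "finite T" by simp
  then show ?thesis
    by (induction T rule: finite_induct) (auto simp: axis_def)
qed

text \<open>
  Walk from \<open>x\<close> to \<open>x + h\<close> along the coordinate axes, one coordinate at a time. By the mean value
  theorem each step changes \<open>u\<close> by \<open>h\<^sub>i\<close> times a partial derivative at a point no farther from
  \<open>x\<close> than \<open>x + h\<close>, and there the partial derivative is close to its value at \<open>x\<close>.
\<close>

lemma has_derivative_of_continuous_partials: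
  fixes u :: "real^'n::finite \<Rightarrow> real"
  assumes "open S" "x \<in> S"
    and part: "\<And>i y. y \<in> S \<Longrightarrow> has_partial_at i u y"
    and cont: "\<And>i. continuous_on S (partial i u)"
  shows "(u has_derivative (\<lambda>h. \<Sum>i\<in>UNIV. h $ i * partial i u x)) (at x)"
  unfolding has_derivative_at_alt
proof (intro conjI allI impI)
  show "bounded_linear (\<lambda>h. \<Sum>i\<in>UNIV. h $ i * partial i u x)"
    by (intro bounded_linear_sum bounded_linear_mult_const bounded_linear_vec_nth)
  fix e :: real assume "e > 0"
  define N where "N = real (card (UNIV :: 'n set))"
  have N: "N > 0" unfolding N_def by simp
  \<comment> \<open>Each of the \<open>N\<close> coordinate steps gets an equal share of the error.\<close>
  define e' where "e' = e / N"
  have e': "e' > 0" using N \<open>e > 0\<close> by (simp add: e'_def)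
  have "eventually (\<lambda>y. y \<in> S \<and> (\<forall>i. dist (partial i u y) (partial i u x) < e')) (nhds x)"
  proof (intro eventually_conj)
    show "eventually (\<lambda>y. y \<in> S) (nhds x)"
      using assms(1,2) by (rule eventually_nhds_in_open)
    have "eventually (\<lambda>y. dist (partial i u y) (partial i u x) < e') (nhds x)" for i
    proof -
      have "isCont (partial i u) x"
        using cont assms(1,2) continuous_on_eq_continuous_at by blast
      then have "(partial i u \<longlongrightarrow> partial i u x) (nhds x)"
        by (simp add: isCont_def tendsto_nhds_iff)
      then show ?thesis using e' by (rule tendstoD)
    qed
    then show "eventually (\<lambda>y. \<forall>i. dist (partial i u y) (partial i u x) < e') (nhds x)"
      by (simp add: eventually_all_finite)
  qed
  then obtain d where d: "d > 0"
    and near: "\<And>y. dist y x < d \<Longrightarrow> y \<in> S"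
      "\<And>y i. dist y x < d \<Longrightarrow> dist (partial i u y) (partial i u x) < e'"
    unfolding eventually_nhds_metric by blast
  have step: "\<bar>u (x + (\<Sum>i\<in>T. h $ i *\<^sub>R axis i 1)) - u x - (\<Sum>i\<in>T. h $ i * partial i u x)\<bar>
      \<le> real (card T) * (e' * norm h)" if h: "norm h < d" for T and h :: "real^'n"
  proof -
    have "finite T" by simp
    then show ?thesis
    proof (induction T rule: finite_induct)
      case empty
      then show ?case by simp
    next
      case (insert k T)
      define y where "y = x + (\<Sum>i\<in>T. h $ i *\<^sub>R axis i 1)"
      define \<gamma> where "\<gamma> t = y + (t * h $ k) *\<^sub>R axis k 1" for t :: real
      have in_ball: "dist (\<gamma> t) x < d" if t: "t \<in> {0..1}" for t
      proof -
        have "norm (\<gamma> t - x) \<le> norm h"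
        proof (rule norm_le_componentwise_cart)
          fix m
          have "(\<gamma> t - x) $ m = (if m \<in> T then h $ m else 0) + (if m = k then t * h $ k else 0)"
            unfolding \<gamma>_def y_def by (simp add: sum_axis_component del: sum_component) (simp add: axis_def)
          then show "norm ((\<gamma> t - x) $ m) \<le> norm (h $ m)"
            using insert.hyps t by (auto simp: abs_mult mult_left_le_one_le)
        qed
        then show ?thesis using h by (simp add: dist_norm)
      qed
      have "\<exists>t\<in>{0..1}. u (\<gamma> 1) - u (\<gamma> 0) = (partial k u (\<gamma> t) * h $ k) * (1 - 0)"
      proof (rule mvt_very_simple[where f' = "\<lambda>t. (*) (partial k u (\<gamma> t) * h $ k)"])
        fix t :: real assume t: "0 \<le> t" "t \<le> 1"
        then have "has_partial_at k u (\<gamma> t)"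
          using near(1)[OF in_ball[of t]] part by auto
        then have "((\<lambda>s. u (y + s *\<^sub>R axis k 1)) has_real_derivative partial k u (\<gamma> t)) (at (t * h $ k))"
          unfolding \<gamma>_def by (rule has_partial_at_imp_DERIV)
        moreover have "((\<lambda>s. s * h $ k) has_real_derivative h $ k) (at t)"
          by (auto intro!: derivative_eq_intros)
        ultimately have "((\<lambda>s. u (\<gamma> s)) has_real_derivative partial k u (\<gamma> t) * h $ k) (at t)"
          unfolding \<gamma>_def by (rule DERIV_chain2)
        then show "((\<lambda>s. u (\<gamma> s)) has_derivative (*) (partial k u (\<gamma> t) * h $ k)) (at t within {0..1})"
          unfolding has_field_derivative_def
          by (rule has_derivative_at_withinI)
      qed simp
      then obtain t where t: "t \<in> {0..1}" and mvt: "u (\<gamma> 1) - u (\<gamma> 0) = partial k u (\<gamma> t) * h $ k"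
        by auto
      have \<gamma>01: "\<gamma> 0 = y" "\<gamma> 1 = x + (\<Sum>i\<in>insert k T. h $ i *\<^sub>R axis i 1)"
        using insert.hyps by (simp_all add: \<gamma>_def y_def add_ac)
      have "\<bar>u (\<gamma> 1) - u y - h $ k * partial k u x\<bar> = \<bar>partial k u (\<gamma> t) - partial k u x\<bar> * \<bar>h $ k\<bar>"
        using mvt \<gamma>01 by (simp flip: abs_mult add: algebra_simps)
      also have "\<dots> \<le> e' * norm h"
        using near(2)[OF in_ball[OF t], of k] component_le_norm_cart[of h k] e'
        by (intro mult_mono) (auto simp: dist_real_def)
      finally have "\<bar>u (\<gamma> 1) - u y - h $ k * partial k u x\<bar> \<le> e' * norm h" .
      moreover have "\<bar>u y - u x - (\<Sum>i\<in>T. h $ i * partial i u x)\<bar> \<le> real (card T) * (e' * norm h)"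
        using insert.IH by (simp add: y_def)
      ultimately show ?case
        using insert.hyps unfolding \<gamma>01(2)[symmetric] by (simp add: distrib_right)
    qed
  qed
  show "\<exists>d>0. \<forall>y. norm (y - x) < d \<longrightarrow>
      norm (u y - u x - (\<Sum>i\<in>UNIV. (y - x) $ i * partial i u x)) \<le> e * norm (y - x)"
  proof (intro exI conjI allI impI)
    fix y assume y: "norm (y - x) < d"
    have "x + (\<Sum>i\<in>UNIV. (y - x) $ i *\<^sub>R axis i 1) = y"
      by (simp add: vec_eq_iff sum_axis_component del: sum_component)
    with step[OF y, of UNIV] show
      "norm (u y - u x - (\<Sum>i\<in>UNIV. (y - x) $ i * partial i u x)) \<le> e * norm (y - x)"
      using N by (simp add: e'_def N_def)
  qed (rule d)
qed

text \<open>
  The derivatives are parameters rather than being computed from \<open>u\<close> by \<open>partial\<close>, so that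
  linear combinations of functions need no rewriting of iterated partial derivatives.
\<close>

definition has_gradient_hessian_on ::
  "(real^'n::finite) set \<Rightarrow> (real^'n \<Rightarrow> real) \<Rightarrow> ('n \<Rightarrow> real^'n \<Rightarrow> real) \<Rightarrow>
   ('n \<Rightarrow> 'n \<Rightarrow> real^'n \<Rightarrow> real) \<Rightarrow> bool" where
  "has_gradient_hessian_on S u G H \<longleftrightarrow> (\<forall>x\<in>S.
     (u has_derivative (\<lambda>h. \<Sum>i\<in>UNIV. h $ i * G i x)) (at x) \<and>
     (\<forall>i. (G i has_derivative (\<lambda>h. \<Sum>j\<in>UNIV. h $ j * H i j x)) (at x)))"

lemma has_gradient_hessian_on_C_class:
  assumes "open S" "C_class 2 S u"
  shows "has_gradient_hessian_on S u (\<lambda>i. partial i u) (\<lambda>i j. partial j (partial i u))"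
proof -
  have C1: "C_class 1 S (partial i u)" and u: "\<And>x i. x \<in> S \<Longrightarrow> has_partial_at i u x" for i
    using assms(2) by (simp_all add: numeral_2_eq_2)
  then have cont: "continuous_on S (partial i u)" "continuous_on S (partial j (partial i u))"
    and u': "\<And>x. x \<in> S \<Longrightarrow> has_partial_at j (partial i u) x" for i j
    by simp_all
  show ?thesis
    unfolding has_gradient_hessian_on_def
    using has_derivative_of_continuous_partials[OF \<open>open S\<close>] cont u u' by simp
qed

lemma has_gradient_hessian_on_lincomb:
  assumes "has_gradient_hessian_on S u G H" "has_gradient_hessian_on S v G' H'"
  shows "has_gradient_hessian_on S (\<lambda>x. u x + r * v x) (\<lambda>i x. G i x + r * G' i x)
    (\<lambda>i j x. H i j x + r * H' i j x)"
proof -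
  have eq: "(\<lambda>h::real^'a. \<Sum>i\<in>UNIV. h $ i * (p i + r * q i))
      = (\<lambda>h. (\<Sum>i\<in>UNIV. h $ i * p i) + r * (\<Sum>i\<in>UNIV. h $ i * q i))" for p q :: "'a \<Rightarrow> real"
    by (simp add: sum.distrib sum_distrib_left distrib_left mult_ac)
  show ?thesis
    using assms unfolding has_gradient_hessian_on_def eq
    by (auto intro!: has_derivative_add has_derivative_mult_right)
qed

lemma has_gradient_hessian_on_exp:
  "has_gradient_hessian_on S (\<lambda>x. exp (\<gamma> * x $ k))
     (\<lambda>i x. if i = k then \<gamma> * exp (\<gamma> * x $ k) else 0)
     (\<lambda>i j x. if i = k \<and> j = k then \<gamma>\<^sup>2 * exp (\<gamma> * x $ k) else 0)"
proof -
  have exp: "((\<lambda>x. exp (\<gamma> * x $ k)) has_derivative (\<lambda>h. h $ k * (\<gamma> * exp (\<gamma> * x $ k)))) (at x)"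
    for x :: "real^'a"
    by (auto intro!: derivative_eq_intros bounded_linear.has_derivative[OF bounded_linear_vec_nth])
  have exp': "((\<lambda>x. \<gamma> * exp (\<gamma> * x $ k)) has_derivative (\<lambda>h. h $ k * (\<gamma>\<^sup>2 * exp (\<gamma> * x $ k)))) (at x)"
    for x :: "real^'a"
    using has_derivative_mult_right[OF exp, of \<gamma> x] by (simp add: power2_eq_square mult_ac)
  have delta: "(\<Sum>j\<in>UNIV. h $ j * (if j = k then c else 0)) = h $ k * c" for h :: "real^'a" and c
    by (simp add: if_distrib[of "\<lambda>y. _ * y"] cong: if_cong)
  show ?thesis
    unfolding has_gradient_hessian_on_def
  proof (intro ballI conjI allI)
    fix x :: "real^'a" and i
    show "((\<lambda>x. exp (\<gamma> * x $ k)) has_derivative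
        (\<lambda>h. \<Sum>i\<in>UNIV. h $ i * (if i = k then \<gamma> * exp (\<gamma> * x $ k) else 0))) (at x)"
      unfolding delta by (rule exp)
    show "((\<lambda>x. if i = k then \<gamma> * exp (\<gamma> * x $ k) else 0) has_derivative
        (\<lambda>h. \<Sum>j\<in>UNIV. h $ j * (if i = k \<and> j = k then \<gamma>\<^sup>2 * exp (\<gamma> * x $ k) else 0))) (at x)"
      by (cases "i = k") (simp_all add: delta exp')
  qed
qed

section \<open>Symmetry of the Hessian and its sign at a maximum\<close>

lemma DERIV_along_line:
  fixes u :: "real^'n::finite \<Rightarrow> real"
  assumes "(u has_derivative (\<lambda>h. \<Sum>i\<in>UNIV. h $ i * g i)) (at (z + t *\<^sub>R \<xi>))"
  shows "((\<lambda>s. u (z + s *\<^sub>R \<xi>)) has_real_derivative (\<Sum>i\<in>UNIV. \<xi> $ i * g i)) (at t)"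
proof -
  have "((\<lambda>s. z + s *\<^sub>R \<xi>) has_derivative (\<lambda>s. s *\<^sub>R \<xi>)) (at t)"
    by (auto intro!: derivative_eq_intros)
  then have "((\<lambda>s. u (z + s *\<^sub>R \<xi>)) has_derivative (\<lambda>s. \<Sum>i\<in>UNIV. (s *\<^sub>R \<xi>) $ i * g i)) (at t)"
    using assms by (rule has_derivative_compose)
  then show ?thesis
    by (auto simp: has_field_derivative_def sum_distrib_left mult_ac fun_eq_iff elim!: has_derivative_eq_rhs)
qed

lemma DERIV_along_axis:
  fixes u :: "real^'n::finite \<Rightarrow> real"
  assumes "(u has_derivative (\<lambda>h. \<Sum>i\<in>UNIV. h $ i * g i)) (at (z + t *\<^sub>R axis k 1))"
  shows "((\<lambda>s. u (z + s *\<^sub>R axis k 1)) has_real_derivative g k) (at t)"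
proof -
  have "(\<Sum>i\<in>UNIV. axis k 1 $ i * g i) = g k"
    by (simp add: axis_def if_distrib[of "\<lambda>y. y * _"] cong: if_cong)
  with DERIV_along_line[OF assms] show ?thesis by simp
qed

text \<open>
  The mean value theorem in direction \<open>i\<close> turns the second difference into \<open>h\<close> times a first
  difference of \<open>G i\<close> in direction \<open>j\<close>, taken at distance at most \<open>2h\<close> from \<open>x\<close>.
  Differentiability of \<open>G i\<close> at the single point \<open>x\<close> then suffices to compare it with
  \<open>h H\<^sub>i\<^sub>j\<close>.
\<close>

lemma second_difference_estimate:
  fixes u :: "real^'n::finite \<Rightarrow> real"
  assumes "open S" "x \<in> S" and jet: "has_gradient_hessian_on S u G H" and "e > 0"
  shows "\<exists>d>0. \<forall>h. 0 < h \<and> h < d \<longrightarrow>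
    \<bar>u (x + h *\<^sub>R axis i 1 + h *\<^sub>R axis j 1) - u (x + h *\<^sub>R axis i 1) - u (x + h *\<^sub>R axis j 1) + u x
      - h\<^sup>2 * H i j x\<bar> \<le> 3 * e * h\<^sup>2"
proof -
  let ?a = "axis i 1 :: real^'n" and ?b = "axis j 1 :: real^'n"
  obtain d1 where d1: "d1 > 0" "ball x d1 \<subseteq> S"
    using assms(1,2) openE by blast
  have "(G i has_derivative (\<lambda>h. \<Sum>j\<in>UNIV. h $ j * H i j x)) (at x)"
    using jet \<open>x \<in> S\<close> unfolding has_gradient_hessian_on_def by blast
  then obtain d2 where d2: "d2 > 0" and lin: "\<And>y. norm (y - x) < d2 \<Longrightarrow>
      norm (G i y - G i x - (\<Sum>j\<in>UNIV. (y - x) $ j * H i j x)) \<le> e * norm (y - x)"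
    using \<open>e > 0\<close> unfolding has_derivative_at_alt by blast
  show ?thesis
  proof (intro exI conjI allI impI)
    \<comment> \<open>Halving keeps all corners of the square with side \<open>h\<close> within both radii.\<close>
    show "min d1 d2 / 2 > 0" using d1 d2 by simp
    fix h :: real assume h: "0 < h \<and> h < min d1 d2 / 2"
    have norm_le: "norm (s *\<^sub>R ?a + r *\<^sub>R ?b) \<le> s + r" if "0 \<le> s" "0 \<le> r" for s r :: real
      using that norm_triangle_ineq[of "s *\<^sub>R ?a" "r *\<^sub>R ?b"] by simp
    define \<phi> where "\<phi> s = u (x + h *\<^sub>R ?b + s *\<^sub>R ?a) - u (x + s *\<^sub>R ?a)" for s
    define \<phi>' where "\<phi>' s = G i (x + h *\<^sub>R ?b + s *\<^sub>R ?a) - G i (x + s *\<^sub>R ?a)" for s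
    have der: "(\<phi> has_real_derivative \<phi>' s) (at s)" if s: "0 \<le> s" "s \<le> h" for s
    proof -
      have "x + h *\<^sub>R ?b + s *\<^sub>R ?a \<in> S" "x + s *\<^sub>R ?a \<in> S"
        using norm_le[of s h] norm_le[of s 0] s h d1(2)
        by (auto intro!: subsetD[OF d1(2)] simp: dist_norm norm_minus_commute add_ac)
      then show ?thesis
        unfolding \<phi>_def \<phi>'_def using jet
        by (intro DERIV_diff DERIV_along_axis[where g = "\<lambda>i. G i _"])
          (auto simp: has_gradient_hessian_on_def)
    qed
    obtain s where s: "0 < s" "s < h" and mvt: "\<phi> h - \<phi> 0 = (h - 0) * \<phi>' s"
      using MVT2[of 0 h \<phi> \<phi>'] der h by auto
    have 1: "\<bar>G i (x + h *\<^sub>R ?b + s *\<^sub>R ?a) - G i x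
        - (\<Sum>m\<in>UNIV. (h *\<^sub>R ?b + s *\<^sub>R ?a) $ m * H i m x)\<bar> \<le> e * (s + h)"
    proof -
      have n: "norm (h *\<^sub>R ?b + s *\<^sub>R ?a) \<le> s + h"
        using norm_le[of s h] s h by (simp add: add_ac)
      have "norm (h *\<^sub>R ?b + s *\<^sub>R ?a) < d2" using n s h by linarith
      then have "\<bar>G i (x + h *\<^sub>R ?b + s *\<^sub>R ?a) - G i x
          - (\<Sum>m\<in>UNIV. (h *\<^sub>R ?b + s *\<^sub>R ?a) $ m * H i m x)\<bar> \<le> e * norm (h *\<^sub>R ?b + s *\<^sub>R ?a)"
        using lin[of "x + h *\<^sub>R ?b + s *\<^sub>R ?a"] by (simp add: add.assoc)
      also have "\<dots> \<le> e * (s + h)" using n \<open>e > 0\<close> by simp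
      finally show ?thesis .
    qed
    have 2: "\<bar>G i (x + s *\<^sub>R ?a) - G i x - (\<Sum>m\<in>UNIV. (s *\<^sub>R ?a) $ m * H i m x)\<bar> \<le> e * s"
      using lin[of "x + s *\<^sub>R ?a"] s h by simp
    \<comment> \<open>The linear parts at the two points differ exactly by the wanted mixed term.\<close>
    have 3: "(\<Sum>m\<in>UNIV. (h *\<^sub>R ?b + s *\<^sub>R ?a) $ m * H i m x)
        = h * H i j x + (\<Sum>m\<in>UNIV. (s *\<^sub>R ?a) $ m * H i m x)"
      by (simp add: distrib_right sum.distrib)
        (simp add: axis_def if_distrib[of "\<lambda>y. y * _"] if_distrib[of "\<lambda>y. _ * y"] cong: if_cong)
    have "\<bar>\<phi>' s - h * H i j x\<bar> \<le> e * (s + h) + e * s"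
      using 1 2 unfolding 3 \<phi>'_def by linarith
    also have "\<dots> \<le> 3 * e * h"
      using s \<open>e > 0\<close> mult_left_mono[of s h e] by (simp add: distrib_left)
    finally have "h * \<bar>\<phi>' s - h * H i j x\<bar> \<le> h * (3 * e * h)"
      using h by (intro mult_left_mono) auto
    moreover have "h * \<bar>\<phi>' s - h * H i j x\<bar> = \<bar>\<phi> h - \<phi> 0 - h\<^sup>2 * H i j x\<bar>"
    proof -
      have "\<phi> h - \<phi> 0 - h\<^sup>2 * H i j x = h * (\<phi>' s - h * H i j x)"
        using mvt by (simp add: power2_eq_square algebra_simps)
      then show ?thesis using h by (simp add: abs_mult)
    qed
    moreover have "\<phi> h - \<phi> 0 = u (x + h *\<^sub>R ?a + h *\<^sub>R ?b) - u (x + h *\<^sub>R ?a) - u (x + h *\<^sub>R ?b) + u x"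
      by (simp add: \<phi>_def add_ac)
    ultimately show "\<bar>u (x + h *\<^sub>R ?a + h *\<^sub>R ?b) - u (x + h *\<^sub>R ?a) - u (x + h *\<^sub>R ?b) + u x
        - h\<^sup>2 * H i j x\<bar> \<le> 3 * e * h\<^sup>2"
      by (simp add: power2_eq_square mult_ac)
  qed
qed

text \<open>
  The second difference is symmetric in the two directions, and it determines the mixed
  derivative in the limit \<open>h \<rightarrow> 0\<close>.
\<close>

lemma hessian_symmetric:
  fixes u :: "real^'n::finite \<Rightarrow> real"
  assumes "open S" "x \<in> S" "has_gradient_hessian_on S u G H"
  shows "H i j x = H j i x"
proof (rule ccontr)
  assume "H i j x \<noteq> H j i x"
  \<comment> \<open>Two errors of \<open>3 e h\<^sup>2\<close> have to stay below the assumed difference \<open>12 e h\<^sup>2\<close>.\<close>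
  define e where "e = \<bar>H i j x - H j i x\<bar> / 12"
  have e: "e > 0" using \<open>H i j x \<noteq> H j i x\<close> by (simp add: e_def)
  define \<Delta> where "\<Delta> i j h = u (x + h *\<^sub>R axis i 1 + h *\<^sub>R axis j 1)
    - u (x + h *\<^sub>R axis i 1) - u (x + h *\<^sub>R axis j 1) + u x" for i j h
  have \<Delta>_sym: "\<Delta> i j h = \<Delta> j i h" for h
    by (simp add: \<Delta>_def add_ac)
  obtain d1 where d1: "d1 > 0" "\<And>h. 0 < h \<Longrightarrow> h < d1 \<Longrightarrow> \<bar>\<Delta> i j h - h\<^sup>2 * H i j x\<bar> \<le> 3 * e * h\<^sup>2"
    using second_difference_estimate[OF assms e] unfolding \<Delta>_def by meson
  obtain d2 where d2: "d2 > 0" "\<And>h. 0 < h \<Longrightarrow> h < d2 \<Longrightarrow> \<bar>\<Delta> j i h - h\<^sup>2 * H j i x\<bar> \<le> 3 * e * h\<^sup>2"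
    using second_difference_estimate[OF assms e] unfolding \<Delta>_def by meson
  obtain h where h: "0 < h" "h < d1" "h < d2"
    using d1(1) d2(1) by (metis field_lbound_gt_zero)
  have "\<bar>h\<^sup>2 * H i j x - h\<^sup>2 * H j i x\<bar> \<le> 6 * e * h\<^sup>2"
    using d1(2)[of h] d2(2)[of h] h \<Delta>_sym[of h] by linarith
  moreover have "\<bar>h\<^sup>2 * H i j x - h\<^sup>2 * H j i x\<bar> = 12 * e * h\<^sup>2"
    by (simp add: e_def abs_mult flip: right_diff_distrib)
  ultimately show False using e h by simp
qed

text \<open>
  Restrict \<open>u\<close> to the line through \<open>x\<close> in direction \<open>\<xi>\<close>. Its first derivative vanishes at \<open>x\<close>,
  so a positive second derivative would make \<open>u\<close> increase when leaving \<open>x\<close>.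
\<close>

lemma gradient_hessian_at_maximum:
  fixes u :: "real^'n::finite \<Rightarrow> real"
  assumes "open S" "x \<in> S" and jet: "has_gradient_hessian_on S u G H"
    and max: "\<And>y. y \<in> S \<Longrightarrow> u y \<le> u x"
  shows "G i x = 0" and "(\<Sum>i\<in>UNIV. \<Sum>j\<in>UNIV. H i j x * \<xi> $ i * \<xi> $ j) \<le> 0"
proof -
  have der: "(u has_derivative (\<lambda>h. \<Sum>i\<in>UNIV. h $ i * G i y)) (at y)"
    and der2: "(G i has_derivative (\<lambda>h. \<Sum>j\<in>UNIV. h $ j * H i j y)) (at y)" if "y \<in> S" for y i
    using jet that unfolding has_gradient_hessian_on_def by blast+
  have G0: "G i x = 0" for i
  proof -
    have "(\<lambda>h::real^'n. \<Sum>i\<in>UNIV. h $ i * G i x) = (\<lambda>h. 0)"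
      using differential_zero_maxmin[OF assms(2,1) der[OF assms(2)]] max by blast
    then have "(\<Sum>m\<in>UNIV. axis i 1 $ m * G m x) = 0" by meson
    then show ?thesis
      by (simp add: axis_def if_distrib[of "\<lambda>y. y * _"] cong: if_cong)
  qed
  show "G i x = 0" by (rule G0)
  define Q where "Q = (\<Sum>i\<in>UNIV. \<Sum>j\<in>UNIV. H i j x * \<xi> $ i * \<xi> $ j)"
  define \<phi> where "\<phi> t = u (x + t *\<^sub>R \<xi>)" for t
  define \<phi>' where "\<phi>' t = (\<Sum>i\<in>UNIV. \<xi> $ i * G i (x + t *\<^sub>R \<xi>))" for t
  have "Q \<le> 0"
  proof (rule ccontr)
    assume "\<not> Q \<le> 0"
    then have Q: "Q > 0" by simp
    have "((\<lambda>t. x + t *\<^sub>R \<xi>) \<longlongrightarrow> x + 0 *\<^sub>R \<xi>) (nhds 0)"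
      by (intro tendsto_intros filterlim_ident)
    then have "eventually (\<lambda>t. x + t *\<^sub>R \<xi> \<in> S) (nhds 0)"
      using assms(1,2) by (auto simp: topological_tendstoD)
    then obtain d1 where d1: "d1 > 0" "\<And>t. \<bar>t\<bar> < d1 \<Longrightarrow> x + t *\<^sub>R \<xi> \<in> S"
      unfolding eventually_nhds_metric by auto
    have d\<phi>: "(\<phi> has_real_derivative \<phi>' t) (at t)" if "\<bar>t\<bar> < d1" for t
      unfolding \<phi>_def \<phi>'_def using d1(2)[OF that] by (intro DERIV_along_line der)
    have "(\<phi>' has_real_derivative (\<Sum>i\<in>UNIV. \<xi> $ i * (\<Sum>j\<in>UNIV. \<xi> $ j * H i j x))) (at 0)"
      unfolding \<phi>'_def using assms(2)
      by (intro DERIV_sum DERIV_cmult DERIV_along_line) (auto intro: der2)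
    also have "(\<Sum>i\<in>UNIV. \<xi> $ i * (\<Sum>j\<in>UNIV. \<xi> $ j * H i j x)) = Q"
      by (simp add: Q_def sum_distrib_left mult_ac)
    finally have "\<exists>d>0. \<forall>t>0. t < d \<longrightarrow> \<phi>' 0 < \<phi>' (0 + t)"
      using Q by (rule DERIV_pos_inc_right)
    then obtain d2 where d2: "d2 > 0" "\<And>t. 0 < t \<Longrightarrow> t < d2 \<Longrightarrow> \<phi>' 0 < \<phi>' t"
      by auto
    have \<phi>'0: "\<phi>' 0 = 0" by (simp add: \<phi>'_def G0)
    obtain t where t: "0 < t" "t < d1" "t < d2"
      using d1(1) d2(1) by (metis field_lbound_gt_zero)
    obtain s where s: "0 < s" "s < t" "\<phi> t - \<phi> 0 = (t - 0) * \<phi>' s"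
      using MVT2[of 0 t \<phi> \<phi>'] d\<phi> t by auto
    have "\<phi> t > \<phi> 0"
      using s t d2(2)[of s] \<phi>'0 by (metis diff_gt_0_iff_gt diff_zero mult_pos_pos less_trans)
    moreover have "\<phi> t \<le> \<phi> 0"
      using max[OF d1(2)[of t]] t by (simp add: \<phi>_def)
    ultimately show False by simp
  qed
  then show "(\<Sum>i\<in>UNIV. \<Sum>j\<in>UNIV. H i j x * \<xi> $ i * \<xi> $ j) \<le> 0" by (simp add: Q_def)
qed

section \<open>The maximum principle and the stability estimate\<close>

text \<open>
  Where \<open>w > M \<ge> 0\<close> the zeroth-order term \<open>c w\<close> is nonpositive, so there \<open>w\<close> is a subsolution
  of the operator without that term. The perturbation argument for that operator is carried out
  on a compact superlevel set, where \<open>b\<close> is bounded.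
\<close>

lemma maximum_principle:
  fixes w :: "real^'n::finite \<Rightarrow> real"
  assumes "open \<Omega>" "bounded \<Omega>"
    and ell: "uniformly_elliptic \<Omega> a"
    and b_cont: "\<And>i. continuous_on \<Omega> (b i)"
    and c_nonpos: "\<And>x. x \<in> \<Omega> \<Longrightarrow> c x \<le> 0"
    and jet: "has_gradient_hessian_on \<Omega> w G H"
    and w_cont: "continuous_on (closure \<Omega>) w"
    and subsol: "\<And>x. x \<in> \<Omega> \<Longrightarrow>
      (\<Sum>i\<in>UNIV. \<Sum>j\<in>UNIV. a i j x * H i j x) + (\<Sum>i\<in>UNIV. b i x * G i x) + c x * w x \<ge> 0"
    and bdry: "\<And>x. x \<in> frontier \<Omega> \<Longrightarrow> w x \<le> M" and "M \<ge> 0"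
    and x1: "x1 \<in> closure \<Omega>"
  shows "w x1 \<le> M"
proof (rule ccontr)
  assume "\<not> w x1 \<le> M"
  define m where "m = (M + w x1) / 2"
  have m: "M < m" "m < w x1" using \<open>\<not> w x1 \<le> M\<close> by (auto simp: m_def)
  define K where "K = {x \<in> closure \<Omega>. m \<le> w x}"
  have cl: "compact (closure \<Omega>)" using \<open>bounded \<Omega>\<close> by simp
  have K_sub: "K \<subseteq> \<Omega>"
    using bdry m \<open>open \<Omega>\<close> unfolding K_def frontier_def by (force simp: interior_open)
  have "K = closure \<Omega> \<inter> w -` {m..}" by (auto simp: K_def)
  then have "closed K"
    using continuous_closed_preimage[OF w_cont] by simp
  then have "compact K"
    using cl K_def compact_eq_bounded_closed bounded_subset by (metis (no_types, lifting) mem_Collect_eq subsetI)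
  \<comment> \<open>Any coordinate direction will do.\<close>
  define k :: 'n where "k = undefined"
  obtain B where B: "B > 0" "\<And>x. x \<in> K \<Longrightarrow> \<bar>b k x\<bar> \<le> B"
  proof -
    have "compact (b k ` K)"
      using \<open>compact K\<close> b_cont K_sub by (metis compact_continuous_image continuous_on_subset)
    then show thesis
      using that by (auto simp: bounded_pos dest!: compact_imp_bounded)
  qed
  obtain \<theta> where \<theta>: "\<theta> > 0"
    and elliptic: "\<And>x \<xi>. x \<in> \<Omega> \<Longrightarrow>
      \<theta> * (\<Sum>i\<in>UNIV. (\<xi> $ i)\<^sup>2) \<le> (\<Sum>i\<in>UNIV. \<Sum>j\<in>UNIV. a i j x * \<xi> $ i * \<xi> $ j)"
    using ell unfolding uniformly_elliptic_def by blast
  \<comment> \<open>Chosen such that \<open>a\<^sub>k\<^sub>k \<gamma>\<^sup>2 + b\<^sub>k \<gamma> > 0\<close> on \<open>K\<close>.\<close>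
  define \<gamma> where "\<gamma> = (B + 1) / \<theta>"
  have \<gamma>: "\<gamma> > 0" "\<gamma> * \<theta> > B" using B \<theta> by (auto simp: \<gamma>_def)
  define \<psi> where "\<psi> x = exp (\<gamma> * x $ k)" for x :: "real^'n"
  have \<psi>_cont: "continuous_on (closure \<Omega>) \<psi>"
    unfolding \<psi>_def by (intro continuous_intros)
  obtain E where E: "E > 0" "\<And>x. x \<in> closure \<Omega> \<Longrightarrow> \<psi> x \<le> E"
  proof -
    have "compact (\<psi> ` closure \<Omega>)"
      using cl \<psi>_cont by (rule compact_continuous_image[rotated])
    then show thesis
      using that by (force simp: bounded_pos dest!: compact_imp_bounded)
  qed
  \<comment> \<open>Small enough for the maximum of the perturbed function to lie in \<open>K\<close>.\<close>
  define \<delta> where "\<delta> = (w x1 - m) / E"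
  have \<delta>: "\<delta> > 0" using m E by (simp add: \<delta>_def)
  define h where "h x = w x + \<delta> * \<psi> x" for x
  have "continuous_on (closure \<Omega>) h"
    unfolding h_def by (intro continuous_intros w_cont \<psi>_cont)
  then obtain x0 where x0: "x0 \<in> closure \<Omega>" and h_max: "\<And>y. y \<in> closure \<Omega> \<Longrightarrow> h y \<le> h x0"
    using continuous_attains_sup[OF cl] x1 by (metis empty_iff)
  have "w x1 < h x1" using \<delta> by (simp add: h_def \<psi>_def)
  also have "h x1 \<le> w x0 + \<delta> * E"
    using h_max[OF x1] E(2)[OF x0] \<delta> by (simp add: h_def) (smt (verit) mult_left_mono)
  also have "\<delta> * E = w x1 - m" using E by (simp add: \<delta>_def)
  finally have wx0: "m \<le> w x0" by simp
  then have "x0 \<in> K" using x0 by (simp add: K_def)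
  then have x0_in: "x0 \<in> \<Omega>" using K_sub by blast
  define G' where "G' i x = G i x + \<delta> * (if i = k then \<gamma> * \<psi> x else 0)" for i x
  define H' where "H' i j x = H i j x + \<delta> * (if i = k \<and> j = k then \<gamma>\<^sup>2 * \<psi> x else 0)" for i j x
  have jet': "has_gradient_hessian_on \<Omega> h G' H'"
    unfolding h_def G'_def H'_def \<psi>_def
    by (rule has_gradient_hessian_on_lincomb[OF jet has_gradient_hessian_on_exp])
  have h_max': "\<And>y. y \<in> \<Omega> \<Longrightarrow> h y \<le> h x0"
    using h_max closure_subset by blast
  note at_max = gradient_hessian_at_maximum[OF \<open>open \<Omega>\<close> x0_in jet' h_max']
  have "(\<Sum>i\<in>UNIV. \<Sum>j\<in>UNIV. a i j x0 * H' i j x0) \<le> 0"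
  proof (rule trace_product_nonpos[OF finite \<theta>])
    show "H' i j x0 = H' j i x0" for i j
      by (rule hessian_symmetric[OF \<open>open \<Omega>\<close> x0_in jet'])
    show "\<theta> * (\<Sum>i\<in>UNIV. (\<xi> i)\<^sup>2) \<le> (\<Sum>i\<in>UNIV. \<Sum>j\<in>UNIV. a i j x0 * \<xi> i * \<xi> j)" for \<xi>
      using elliptic[OF x0_in, of "\<chi> i. \<xi> i"] by simp
    show "(\<Sum>i\<in>UNIV. \<Sum>j\<in>UNIV. H' i j x0 * \<xi> i * \<xi> j) \<le> 0" for \<xi>
      using at_max(2)[of "\<chi> i. \<xi> i"] by simp
  qed
  moreover have "(\<Sum>i\<in>UNIV. \<Sum>j\<in>UNIV. a i j x0 * H' i j x0)
      = (\<Sum>i\<in>UNIV. \<Sum>j\<in>UNIV. a i j x0 * H i j x0) + a k k x0 * (\<delta> * \<gamma>\<^sup>2 * \<psi> x0)"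
  proof -
    have "(\<Sum>i\<in>UNIV. \<Sum>j\<in>UNIV. a i j x0 * (\<delta> * (if i = k \<and> j = k then \<gamma>\<^sup>2 * \<psi> x0 else 0)))
        = (\<Sum>i\<in>UNIV. if i = k then a k k x0 * (\<delta> * \<gamma>\<^sup>2 * \<psi> x0) else 0)"
      by (intro sum.cong) (auto simp: if_distrib[of "\<lambda>y. _ * y"] mult_ac cong: if_cong)
    then show ?thesis by (simp add: H'_def distrib_left sum.distrib)
  qed
  moreover have "(\<Sum>i\<in>UNIV. b i x0 * G i x0) = - (b k x0 * (\<delta> * \<gamma> * \<psi> x0))"
  proof -
    have "0 = (\<Sum>i\<in>UNIV. b i x0 * G' i x0)" by (simp add: at_max(1))
    also have "\<dots> = (\<Sum>i\<in>UNIV. b i x0 * G i x0)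
        + (\<Sum>i\<in>UNIV. if i = k then b k x0 * (\<delta> * \<gamma> * \<psi> x0) else 0)"
      unfolding sum.distrib[symmetric] by (intro sum.cong) (auto simp: G'_def distrib_left mult_ac)
    finally show ?thesis by simp
  qed
  moreover have "c x0 * w x0 \<le> 0"
    using c_nonpos[OF x0_in] wx0 m \<open>M \<ge> 0\<close> by (intro mult_nonpos_nonneg) auto
  ultimately have "\<delta> * \<gamma> * \<psi> x0 * (\<gamma> * a k k x0 + b k x0) \<le> 0"
    using subsol[OF x0_in] by (simp add: algebra_simps power2_eq_square)
  moreover have "\<gamma> * a k k x0 + b k x0 > 0"
  proof -
    have "\<theta> \<le> a k k x0"
      using elliptic[OF x0_in, of "axis k 1"]
      by (simp add: axis_def if_distrib[of "\<lambda>y. y\<^sup>2"] if_distrib[of "\<lambda>y. _ * y"] cong: if_cong)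
    then have "\<gamma> * \<theta> \<le> \<gamma> * a k k x0" using \<gamma> by simp
    with \<gamma>(2) B(2)[OF \<open>x0 \<in> K\<close>] show ?thesis by linarith
  qed
  moreover have "\<delta> * \<gamma> * \<psi> x0 > 0" using \<delta> \<gamma> by (simp add: \<psi>_def)
  ultimately show False by (smt (verit) mult_pos_pos)
qed

lemma dirichlet_comparison:
  fixes u v :: "real^'n::finite \<Rightarrow> real"
  assumes "open \<Omega>" "bounded \<Omega>"
    and "uniformly_elliptic \<Omega> a"
    and "\<And>i. continuous_on \<Omega> (b i)"
    and "\<And>x. x \<in> \<Omega> \<Longrightarrow> c x \<le> 0"
    and u: "dirichlet_solution (diff_op a b c) \<Omega> f g u"
    and v: "dirichlet_solution (diff_op a b c) \<Omega> f g' v"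
    and "\<And>x. x \<in> frontier \<Omega> \<Longrightarrow> g' x - g x \<le> M" and "M \<ge> 0"
    and "x \<in> closure \<Omega>"
  shows "v x - u x \<le> M"
proof -
  let ?G = "\<lambda>i x. partial i v x + (-1) * partial i u x"
  let ?H = "\<lambda>i j x. partial j (partial i v) x + (-1) * partial j (partial i u) x"
  have jet: "has_gradient_hessian_on \<Omega> (\<lambda>x. v x + (-1) * u x) ?G ?H"
  proof (rule has_gradient_hessian_on_lincomb; rule has_gradient_hessian_on_C_class[OF \<open>open \<Omega>\<close>])
    show "C_class 2 \<Omega> v" "C_class 2 \<Omega> u"
      using u v unfolding dirichlet_solution_def by blast+
  qed
  have "v x + (-1) * u x \<le> M"
  proof (rule maximum_principle[OF assms(1-5) jet])
    show "continuous_on (closure \<Omega>) (\<lambda>x. v x + (-1) * u x)"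
      using u v unfolding dirichlet_solution_def by (intro continuous_intros) auto
    show "v y + (-1) * u y \<le> M" if "y \<in> frontier \<Omega>" for y
      using u v assms(8)[OF that] that unfolding dirichlet_solution_def by auto
    show "0 \<le> (\<Sum>i\<in>UNIV. \<Sum>j\<in>UNIV. a i j y * ?H i j y) + (\<Sum>i\<in>UNIV. b i y * ?G i y)
        + c y * (v y + (-1) * u y)" if "y \<in> \<Omega>" for y
    proof -
      have "diff_op a b c v y - diff_op a b c u y = 0"
        using u v that unfolding dirichlet_solution_def by simp
      then show ?thesis
        by (simp add: diff_op_def right_diff_distrib sum_subtractf)
    qed
  qed (use assms(9,10) in auto)
  then show ?thesis by simp
qed

theorem theorem2p3:
  fixes \<Omega> :: "(real^'n::finite) set"
    and a :: "'n \<Rightarrow> 'n \<Rightarrow> real^'n \<Rightarrow> real"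
    and b :: "'n \<Rightarrow> real^'n \<Rightarrow> real"
    and c f g \<epsilon> u v :: "real^'n \<Rightarrow> real"
  assumes "bounded_domain \<Omega>"
    and "\<And>i j. continuous_on \<Omega> (a i j)"
    and "\<And>i. continuous_on \<Omega> (b i)"
    and "continuous_on \<Omega> c"
    and "uniformly_elliptic \<Omega> a"
    and "\<And>x. x \<in> \<Omega> \<Longrightarrow> c x \<le> 0"
    and "dirichlet_solution (diff_op a b c) \<Omega> f g u"
    and "dirichlet_solution (diff_op a b c) \<Omega> f (\<lambda>x. g x + \<epsilon> x) v"
  shows "max_over (closure \<Omega>) (\<lambda>x. \<bar>v x - u x\<bar>) \<le> max_over (frontier \<Omega>) (\<lambda>x. \<bar>\<epsilon> x\<bar>)"
proof -
  have \<Omega>: "open \<Omega>" "bounded \<Omega>" "\<Omega> \<noteq> {}"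
    using assms(1) by (auto simp: bounded_domain_def)
  have cl: "compact (closure \<Omega>)" "closure \<Omega> \<noteq> {}" and fr: "compact (frontier \<Omega>)"
    using \<Omega> by (auto simp: compact_frontier_bounded)
  have fr_ne: "frontier \<Omega> \<noteq> {}"
    using \<Omega> frontier_eq_empty not_bounded_UNIV by blast
  have cont: "continuous_on (closure \<Omega>) (\<lambda>x. \<bar>v x - u x\<bar>)"
    using assms(7,8) unfolding dirichlet_solution_def by (intro continuous_intros) auto
  define M where "M = max_over (frontier \<Omega>) (\<lambda>x. \<bar>\<epsilon> x\<bar>)"
  have eps: "\<epsilon> x = v x - u x" if "x \<in> frontier \<Omega>" for x
    using assms(7,8) that unfolding dirichlet_solution_def by auto
  have "continuous_on (frontier \<Omega>) (\<lambda>x. \<bar>v x - u x\<bar>)"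
    using cont by (rule continuous_on_subset) (auto simp: frontier_def)
  then have "continuous_on (frontier \<Omega>) (\<lambda>x. \<bar>\<epsilon> x\<bar>)"
    using eps by (simp cong: continuous_on_cong)
  then have M_ge: "\<bar>\<epsilon> x\<bar> \<le> M" if "x \<in> frontier \<Omega>" for x
    unfolding M_def using max_over_attained(2)[OF fr fr_ne] that by blast
  then have M: "M \<ge> 0"
    using fr_ne by (meson abs_ge_zero ex_in_conv order_trans)
  have "\<bar>v x - u x\<bar> \<le> M" if x: "x \<in> closure \<Omega>" for x
  proof -
    have "v x - u x \<le> M"
      by (rule dirichlet_comparison[OF \<Omega>(1,2) assms(5,3,6,7,8) _ M x]) (use M_ge in fastforce)+
    moreover have "u x - v x \<le> M"
      by (rule dirichlet_comparison[OF \<Omega>(1,2) assms(5,3,6,8,7) _ M x]) (use M_ge in fastforce)+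
    ultimately show ?thesis by linarith
  qed
  then show ?thesis
    using max_over_attained(1)[OF cl cont] by (auto simp: M_def)
qed

end
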